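(* Every claw-free graph $G$ satisfies $\chi_{\mathrm{pcf}}(G)\le \Delta(G)+6$.
   Context: Graphs are finite and simple. A graph is claw-free if it has no induced subgraph isomorphic to $K_{1,3}$. $\Delta(G)$ is the maximum degree. A proper conflict-free coloring of $G$ is a proper vertex coloring in which, for every non-isolated vertex $v$, some color appears exactly once in the open neighborhood $N(v)$. $\chi_{\mathrm{pcf}}(G)$ is the least $k$ such that $G$ has a proper conflict-free coloring with $k$ colors. *)

theory Defs
  imports "Graph_Theory.Graph_Theory"
begin

text \<open>
  A finite simple graph is a term satisfying the locale predicate \<^locale>\<open>graph\<close>: a finite symmetric
  digraph without loops and parallel arcs, in which an undirected edge is a pair of opposite arcs.
\<close>

text \<open>The predicate \<^const>\<open>complete_bipartite_digraph\<close> is closed under isomorphism.\<close>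

definition claw_free :: "('a, 'b) pre_digraph \<Rightarrow> bool" where
  "claw_free G \<longleftrightarrow> \<not> (\<exists>H. induced_subgraph H G \<and> K\<^bsub>1,3\<^esub> H)"

definition neighborhood :: "('a, 'b) pre_digraph \<Rightarrow> 'a \<Rightarrow> 'a set" where
  "neighborhood G v = {u. v \<rightarrow>\<^bsub>G\<^esub> u}"

text \<open>The element 0 gives the graph without vertices maximum degree 0.\<close>

definition max_degree :: "('a, 'b) pre_digraph \<Rightarrow> nat" where
  "max_degree G = Max (insert 0 ((\<lambda>v. card (neighborhood G v)) ` verts G))"

definition proper_coloring :: "('a, 'b) pre_digraph \<Rightarrow> ('a \<Rightarrow> 'c) \<Rightarrow> bool" where
  "proper_coloring G c \<longleftrightarrow> (\<forall>u v. u \<rightarrow>\<^bsub>G\<^esub> v \<longrightarrow> c u \<noteq> c v)"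

definition pcf_coloring :: "('a, 'b) pre_digraph \<Rightarrow> ('a \<Rightarrow> 'c) \<Rightarrow> bool" where
  "pcf_coloring G c \<longleftrightarrow> proper_coloring G c \<and>
    (\<forall>v\<in>verts G. neighborhood G v \<noteq> {} \<longrightarrow> (\<exists>i. \<exists>!u. u \<in> neighborhood G v \<and> c u = i))"

text \<open>The colors are 0, ..., k - 1; not all of them need to be used.\<close>

definition pcf_colorable :: "('a, 'b) pre_digraph \<Rightarrow> nat \<Rightarrow> bool" where
  "pcf_colorable G k \<longleftrightarrow> (\<exists>c :: 'a \<Rightarrow> nat. c ` verts G \<subseteq> {..<k} \<and> pcf_coloring G c)"

definition pcf_chromatic_number :: "('a, 'b) pre_digraph \<Rightarrow> nat" where
  "pcf_chromatic_number G = (LEAST k. pcf_colorable G k)"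

text \<open>The minimum exists: coloring all vertices differently is conflict-free.\<close>

lemma (in graph) pcf_colorable_card_verts: "pcf_colorable G (card (verts G))"
proof -
  obtain c where c: "bij_betw c (verts G) {0..<card (verts G)}"
    using ex_bij_betw_finite_nat[OF finite_verts] by blast
  have V: "u \<in> verts G \<and> v \<in> verts G \<and> u \<noteq> v" if "u \<rightarrow> v" for u v
    using that adj_not_same by (auto dest: adj_in_verts)
  have "proper_coloring G c"
    unfolding proper_coloring_def using c V by (metis bij_betw_imp_inj_on inj_onD)
  moreover have "\<exists>i. \<exists>!u. u \<in> neighborhood G v \<and> c u = i" if ne: "neighborhood G v \<noteq> {}" for v
  proof -
    obtain w where w: "w \<in> neighborhood G v" using ne by blast
    have "u = w" if "u \<in> neighborhood G v" "c u = c w" for u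
      using that w c V unfolding neighborhood_def
      by (metis bij_betw_imp_inj_on inj_onD mem_Collect_eq)
    then show ?thesis using w by blast
  qed
  moreover have "c ` verts G \<subseteq> {..<card (verts G)}"
    using c by (auto simp: bij_betw_def)
  ultimately show ?thesis
    unfolding pcf_colorable_def pcf_coloring_def by blast
qed

end

theory Submission
  imports Defs
begin

text \<open>
  In a claw-free graph a color occurs at most twice in a neighborhood under a proper coloring, so a vertex
  is satisfied iff some color is odd, i.e. has odd multiplicity, in its neighborhood. Start with any proper
  coloring with \<open>k = \<Delta> + 6\<close> colors and satisfy the vertices one at a time.

  Let \<open>v\<close> be unsatisfied and uncolor a neighbor \<open>q\<close> of \<open>v\<close>. A neighbor \<open>s\<close> of \<open>q\<close> forbids a color iff
  that color is the only odd one in \<open>N(s) - q\<close>. By averaging, \<open>q\<close> can be chosen so that \<open>v\<close> and the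
  common neighbors of \<open>v\<close> and \<open>q\<close> forbid at most three colors. The other neighbors of \<open>q\<close> form a clique.
  If \<open>q\<close> cannot be recolored, two vertices \<open>s, t\<close> of this clique forbid different colors \<open>j, i\<close> that do not
  occur in \<open>N(q)\<close>; give \<open>q\<close> the color \<open>j\<close> and uncolor \<open>t\<close> instead. The vertices endangered by this are
  neighbors of \<open>t\<close> and therefore harmless. The gain is that all colors in \<open>N(t)\<close> except \<open>i\<close> and \<open>j\<close> occur
  twice, so that only about \<open>d(t)/2\<close> colors are blocked by adjacency; after at most one further move of
  this kind the uncolored vertex can be colored.
\<close>

section \<open>Parities of colors, and averaging\<close>

definition odds :: "('a \<Rightarrow> nat) \<Rightarrow> 'a set \<Rightarrow> nat set" where
  "odds c S = {i. odd (card {u \<in> S. c u = i})}"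

lemma odds_cong:
  assumes "\<And>u. u \<in> S \<Longrightarrow> c u = c' u"
  shows "odds c S = odds c' S"
proof -
  have "{u \<in> S. c u = i} = {u \<in> S. c' u = i}" for i using assms by auto
  then show ?thesis by (simp add: odds_def)
qed

lemma odds_subset_image: "odds c S \<subseteq> c ` S"
proof
  fix i assume "i \<in> odds c S"
  then have "{u \<in> S. c u = i} \<noteq> {}" by (auto simp: odds_def dest: odd_card_imp_not_empty)
  then show "i \<in> c ` S" by blast
qed

lemma odds_remove:
  assumes "finite S" "w \<in> S"
  shows "i \<in> odds c S \<longleftrightarrow> (i \<in> odds c (S - {w})) \<noteq> (i = c w)"
proof (cases "i = c w")
  case True
  have "{u \<in> S. c u = i} = insert w {u \<in> S - {w}. c u = i}" using assms True by auto
  then show ?thesis using assms True by (simp add: odds_def)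
next
  case False
  then have "{u \<in> S. c u = i} = {u \<in> S - {w}. c u = i}" using assms by auto
  then show ?thesis using False by (simp add: odds_def)
qed

lemma ex_few:
  assumes "finite A" "finite B" "(\<Sum>b\<in>B. card {a \<in> A. R a b}) < n * card A"
  shows "\<exists>a\<in>A. card {b \<in> B. R a b} < n"
proof (rule ccontr)
  assume "\<not> ?thesis"
  then have "(\<Sum>a\<in>A. n) \<le> (\<Sum>a\<in>A. card {b \<in> B. R a b})"
    by (intro sum_mono) (auto simp: not_less)
  also have "\<dots> = (\<Sum>b\<in>B. card {a \<in> A. R a b})"
    using assms by (intro sum_multicount_gen) auto
  finally show False using assms(3) by (simp add: mult.commute)
qed

section \<open>Colors in the neighborhoods of a claw-free graph\<close>

locale claw_free_nbhds =
  fixes N :: "'a \<Rightarrow> 'a set" and k :: nat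
  assumes fin [simp]: "finite (N v)"
    and sym: "u \<in> N v \<Longrightarrow> v \<in> N u"
    and irrefl [simp]: "v \<notin> N v"
    and claw: "x \<in> N v \<Longrightarrow> y \<in> N v \<Longrightarrow> z \<in> N v \<Longrightarrow> x \<noteq> y \<Longrightarrow> x \<noteq> z \<Longrightarrow> y \<noteq> z
      \<Longrightarrow> y \<in> N x \<or> z \<in> N x \<or> z \<in> N y"
    and deg: "card (N v) + 6 \<le> k"
begin

text \<open>The range is bounded on the whole type, so that junk values are colors below
  \<open>k\<close> as well.\<close>

definition proper_on :: "'a set \<Rightarrow> ('a \<Rightarrow> nat) \<Rightarrow> bool" where
  "proper_on S c \<longleftrightarrow> range c \<subseteq> {..<k} \<and> (\<forall>a\<in>S. \<forall>b\<in>S. b \<in> N a \<longrightarrow> c a \<noteq> c b)"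

text \<open>Three neighbors of \<open>t\<close> with one color would be the leaves of a claw at
  \<open>t\<close>.\<close>

lemma card_color_le_2:
  assumes "proper_on S c" "S \<subseteq> N t"
  shows "card {u \<in> S. c u = i} \<le> 2"
proof (rule ccontr)
  assume "\<not> ?thesis"
  then have "3 \<le> card {u \<in> S. c u = i}" by simp
  then obtain T where T: "T \<subseteq> {u \<in> S. c u = i}" "card T = 3"
    by (meson obtain_subset_with_card_n)
  then obtain x y z where "T = {x, y, z}" "x \<noteq> y" "x \<noteq> z" "y \<noteq> z"
    by (auto simp: card_3_iff)
  with T have "x \<in> S" "y \<in> S" "z \<in> S" "c x = i" "c y = i" "c z = i" by auto
  with \<open>x \<noteq> y\<close> \<open>x \<noteq> z\<close> \<open>y \<noteq> z\<close> show False
    using claw[of x t y z] assms unfolding proper_on_def by (metis subsetD)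
qed

text \<open>Every color on \<open>S\<close> occurs once or twice, and the odd ones are those that
  occur once.\<close>

lemma card_image_odds:
  assumes "proper_on S c" "S \<subseteq> N t"
  shows "2 * card (c ` S) = card S + card (odds c S)"
proof -
  have fS: "finite S" using assms(2) fin finite_subset by blast
  have "card S = (\<Sum>i\<in>c ` S. card {u \<in> S. c u = i})"
    using sum.image_gen[OF fS, of "\<lambda>_. 1::nat" c] by simp
  moreover have "card (odds c S) = (\<Sum>i\<in>c ` S. if i \<in> odds c S then 1 else 0)"
    using odds_subset_image[of c S] fS by (simp add: sum.If_cases Int_absorb1)
  moreover have "card {u \<in> S. c u = i} + (if i \<in> odds c S then 1 else 0) = 2" if "i \<in> c ` S" for i
  proof -
    have "card {u \<in> S. c u = i} \<noteq> 0" using that fS by auto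
    with card_color_le_2[OF assms, of i] 
    have "card {u \<in> S. c u = i} = 1 \<or> card {u \<in> S. c u = i} = 2" by linarith
    then show ?thesis by (auto simp: odds_def)
  qed
  ultimately have "card S + card (odds c S) = (\<Sum>i\<in>c ` S. 2)"
    by (simp add: sum.distrib[symmetric])
  then show ?thesis by simp
qed

lemma card_clique:
  assumes "proper_on S c" "K \<subseteq> S" "S \<subseteq> N t" "\<And>x y. x \<in> K \<Longrightarrow> y \<in> K \<Longrightarrow> x \<noteq> y \<Longrightarrow> y \<in> N x"
  shows "card K \<le> card (c ` S)"
proof -
  have "inj_on c K" using assms unfolding proper_on_def inj_on_def by (meson subsetD)
  then have "card K = card (c ` K)" by (simp add: card_image)
  also have "\<dots> \<le> card (c ` S)"
    using assms(2,3) by (intro card_mono image_mono finite_imageI) (auto intro: finite_subset)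
  finally show ?thesis .
qed

lemma inj_on_odds:
  assumes "proper_on S c" "S \<subseteq> N t"
  shows "inj_on c {u \<in> S. c u \<in> odds c S}"
proof (rule inj_onI)
  fix x y assume x: "x \<in> {u \<in> S. c u \<in> odds c S}" and y: "y \<in> {u \<in> S. c u \<in> odds c S}"
    and eq: "c x = c y"
  have "odd (card {u \<in> S. c u = c x})" using x by (simp add: odds_def)
  moreover have "card {u \<in> S. c u = c x} \<le> 2" using card_color_le_2[OF assms] .
  ultimately have "card {u \<in> S. c u = c x} = 1" by presburger
  then obtain z where z: "{u \<in> S. c u = c x} = {z}" by (auto simp: card_1_singleton_iff)
  have "x \<in> {z}" "y \<in> {z}" unfolding z[symmetric] using x y eq by auto
  then show "x = y" by simp
qed

lemma card_odds_vertices_le: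
  assumes "proper_on S c" "S \<subseteq> N t" "A \<subseteq> {u \<in> S. c u \<in> odds c S}"
  shows "card A \<le> card (odds c S)"
proof (rule card_inj_on_le)
  show "inj_on c A" using inj_on_odds[OF assms(1,2)] assms(3) inj_on_subset by blast
  show "c ` A \<subseteq> odds c S" using assms(3) by auto
  show "finite (odds c S)"
    using odds_subset_image assms(2) fin by (metis finite_imageI finite_subset)
qed

lemma proper_on_subset: "proper_on S c \<Longrightarrow> S' \<subseteq> S \<Longrightarrow> proper_on S' c"
  unfolding proper_on_def by blast

text \<open>Otherwise \<open>w\<close>, \<open>x\<close>, \<open>y\<close> would be the leaves of a
  claw at \<open>t\<close>.\<close>

lemma nonneighbors_clique:
  assumes "w \<in> N t" "x \<in> N t - insert w (N w)" "y \<in> N t - insert w (N w)" "x \<noteq> y"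
  shows "y \<in> N x"
  using claw[of w t x y] assms by blast

section \<open>Recoloring with one uncolored vertex\<close>

definition solves :: "'a set \<Rightarrow> ('a \<Rightarrow> nat) \<Rightarrow> bool" where
  "solves X c \<longleftrightarrow> proper_on UNIV c \<and> (\<forall>t\<in>X. odds c (N t) \<noteq> {})"

text \<open>The vertex \<open>w\<close> carries a token and counts as uncolored; the value \<open>c w\<close> is junk. Its neighbors
  are exempt from the conflict-free condition until \<open>w\<close> gets a color.\<close>

definition token :: "'a set \<Rightarrow> 'a \<Rightarrow> ('a \<Rightarrow> nat) \<Rightarrow> bool" where
  "token X w c \<longleftrightarrow> proper_on (- {w}) c \<and> (\<forall>t\<in>X - N w. odds c (N t) \<noteq> {})"

lemma odds_upd_remove: "odds (c(w := j)) (S - {w}) = odds c (S - {w})"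
  by (rule odds_cong) auto

lemma odds_upd_other: "w \<notin> S \<Longrightarrow> odds (c(w := j)) S = odds c S"
  by (rule odds_cong) auto

lemma odds_upd_in:
  assumes "w \<in> N s"
  shows "i \<in> odds (c(w := j)) (N s) \<longleftrightarrow> (i \<in> odds c (N s - {w})) \<noteq> (i = j)"
  using odds_remove[OF fin assms, of i "c(w := j)"] by (simp add: odds_upd_remove)

text \<open>Coloring \<open>w\<close> flips the parity of \<open>j\<close> alone, so only the set
  \<open>{j}\<close> would become empty.\<close>

lemma odds_upd_nonempty:
  assumes "w \<in> N s" "odds c (N s - {w}) \<noteq> {j}"
  shows "odds (c(w := j)) (N s) \<noteq> {}"
proof
  assume "odds (c(w := j)) (N s) = {}"
  then have "i \<in> odds c (N s - {w}) \<longleftrightarrow> i = j" for i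
    using odds_upd_in[OF assms(1), of i c j] by simp
  then show False using assms(2) by blast
qed

lemma proper_upd:
  assumes "proper_on (- {w}) c" "j < k" "j \<notin> c ` N w"
  shows "proper_on UNIV (c(w := j))"
  unfolding proper_on_def
proof (intro conjI ballI impI)
  show "range (c(w := j)) \<subseteq> {..<k}" using assms by (auto simp: proper_on_def)
  fix a b assume "b \<in> N a"
  moreover from this have "a \<noteq> b" "a \<in> N b" using sym by auto
  ultimately show "(c(w := j)) a \<noteq> (c(w := j)) b"
    using assms by (cases "a = w"; cases "b = w") (auto simp: proper_on_def)
qed

lemma solves_upd:
  assumes "token X w c" "j < k" "j \<notin> c ` N w" "\<And>s. s \<in> X \<inter> N w \<Longrightarrow> odds c (N s - {w}) \<noteq> {j}"
  shows "solves X (c(w := j))"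
  unfolding solves_def
proof (intro conjI ballI)
  show "proper_on UNIV (c(w := j))" using assms proper_upd by (simp add: token_def)
  fix s assume s: "s \<in> X"
  show "odds (c(w := j)) (N s) \<noteq> {}"
  proof (cases "s \<in> N w")
    case True
    then show ?thesis using assms(4) s sym odds_upd_nonempty by blast
  next
    case False
    then have "w \<notin> N s" using sym by blast
    then show ?thesis using assms(1) s False by (simp add: odds_upd_other token_def)
  qed
qed

text \<open>The vertices that lose their only odd color are neighbors of \<open>t\<close>, hence
  exempt once the token is there.\<close>

lemma token_move:
  assumes "token X w c" "j < k" "j \<notin> c ` N w" 
    and "{s \<in> X \<inter> N w. odds c (N s - {w}) = {j}} \<subseteq> N t"
  shows "token X t (c(w := j))"
  unfolding token_def
proof (intro conjI ballI)
  show "proper_on (- {t}) (c(w := j))" 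
    using assms proper_upd[of w c j] by (auto simp: token_def proper_on_def)
  fix s assume s: "s \<in> X - N t"
  show "odds (c(w := j)) (N s) \<noteq> {}"
  proof (cases "s \<in> N w")
    case True
    then show ?thesis using assms(4) s sym odds_upd_nonempty by blast
  next
    case False
    then have "w \<notin> N s" using sym by blast
    then show ?thesis using assms(1) s False by (simp add: odds_upd_other token_def)
  qed
qed

text \<open>When \<open>w\<close> cannot be colored, at least \<open>d(w)/2 + 5\<close> colors outside \<open>c ` N w\<close> are forbidden by
  neighbors of \<open>w\<close>. The token then moves to one of these neighbors, which again sees exactly two odd colors
  and can be colored.\<close>

lemma solve_two_odds:
  assumes tok: "token X w c" and two: "card (odds c (N w)) = 2"
  shows "\<exists>c'. solves X c'"
proof -
  define o1 where "o1 s = odds c (N s - {w})" for s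
  define J where "J = {j. \<exists>s\<in>X \<inter> N w. o1 s = {j}} - c ` N w"
  have pr: "proper_on (- {w}) c" using tok by (simp add: token_def)
  have prw: "proper_on (N w) c" by (rule proper_on_subset[OF pr]) auto
  have prs: "proper_on (N s - {w}) c" for s by (rule proper_on_subset[OF pr]) auto
  have ck: "c u < k" for u using pr by (auto simp: proper_on_def)
  have cw: "2 * card (c ` N w) = card (N w) + 2"
    using card_image_odds[OF prw, of w] two by simp
  have Jk: "J \<subseteq> {..<k}"
    using odds_subset_image[of c] ck by (fastforce simp: J_def o1_def)
  then have fJ: "finite J" using finite_subset by blast
  show ?thesis
  proof (cases "{..<k} \<subseteq> c ` N w \<union> J")
    case False
    then obtain g where "g < k" "g \<notin> c ` N w" "g \<notin> J" by auto
    then have "solves X (c(w := g))"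
      by (intro solves_upd[OF tok]) (auto simp: J_def o1_def)
    then show ?thesis by blast
  next
    case True
    have "k \<le> card (c ` N w \<union> J)"
      using card_mono[OF _ True] fJ by simp
    then have "k \<le> card (c ` N w) + card J" using card_Un_le le_trans by blast
    with cw deg[of w] have Jbig: "card (N w) + 10 \<le> 2 * card J" by linarith
    have "\<forall>j\<in>J. \<exists>s. s \<in> X \<inter> N w \<and> o1 s = {j}" by (auto simp: J_def)
    then obtain r where r: "\<And>j. j \<in> J \<Longrightarrow> r j \<in> X \<inter> N w \<and> o1 (r j) = {j}" by metis
    define F where "F = r ` J"
    have "inj_on r J" using r by (metis inj_onI singleton_inject)
    then have cF: "card F = card J" by (simp add: F_def card_image)
    \<comment> \<open>After the token has moved from \<open>w\<close> to \<open>t\<close>, a common neighbor \<open>s\<close> of both can forbid a color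
      other than \<open>c t\<close> and the new color of \<open>w\<close> only if \<open>s \<in> S\<close> and \<open>c t \<in> o1 s\<close>.\<close>
    define S where "S = {s \<in> N w. card (o1 s) = 3}"
    have FN: "F \<subseteq> N w" using r by (auto simp: F_def)
    have fF: "finite F" using FN by (rule finite_subset) simp
    have fS: "finite S" by (simp add: S_def)
    have "F \<inter> S = {}" using r by (fastforce simp: F_def S_def)
    then have "card F + card S = card (F \<union> S)" using fF fS by (simp add: card_Un_disjoint)
    also have "\<dots> \<le> card (N w)" using FN by (intro card_mono) (auto simp: S_def)
    finally have FS: "card F + card S \<le> card (N w)" .
    \<comment> \<open>Each \<open>s\<close> in \<open>S\<close> has three odd colors, each on one
      vertex, so it counts for at most three \<open>t\<close>. As \<open>card S < card F\<close>,
      some \<open>t\<close> is counted fewer than three times.\<close>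
    have "(\<Sum>s\<in>S. card {t \<in> F. t \<in> N s \<and> c t \<in> o1 s}) \<le> (\<Sum>s\<in>S. 3)"
    proof (rule sum_mono)
      fix s assume "s \<in> S"
      then have "card (odds c (N s - {w})) = 3" by (simp add: S_def o1_def)
      then show "card {t \<in> F. t \<in> N s \<and> c t \<in> o1 s} \<le> 3"
        using card_odds_vertices_le[OF prs, of s s "{t \<in> F. t \<in> N s \<and> c t \<in> o1 s}"] FN
        by (force simp: o1_def)
    qed
    also have "\<dots> < 3 * card F" using FS Jbig cF by simp
    finally obtain t where t: "t \<in> F" and few: "card {s \<in> S. t \<in> N s \<and> c t \<in> o1 s} < 3"
      using ex_few[OF fF fS, of "\<lambda>t s. t \<in> N s \<and> c t \<in> o1 s" 3] by blast
    obtain i where i: "i \<in> J" "t = r i" using t by (auto simp: F_def)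
    have tw: "t \<in> N w" "t \<in> X" "o1 t = {i}" using r[OF i(1)] i(2) by auto
    then have wt: "w \<in> N t" "t \<noteq> w" using sym by auto
    \<comment> \<open>Otherwise \<open>card J - 1\<close> neighbors of \<open>w\<close> not adjacent
      to \<open>t\<close> form a clique, too large for the number of colors on
      \<open>N w\<close>.\<close>
    have "\<exists>j\<in>J - {i}. {s \<in> X \<inter> N w. o1 s = {j}} \<subseteq> N t"
    proof (rule ccontr)
      assume "\<not> ?thesis"
      then have "\<forall>j\<in>J - {i}. \<exists>s. s \<in> N w \<and> o1 s = {j} \<and> s \<notin> N t" by blast
      then obtain h where h: "\<And>j. j \<in> J - {i} \<Longrightarrow> h j \<in> N w \<and> o1 (h j) = {j} \<and> h j \<notin> N t"
        by metis
      have "inj_on h (J - {i})" using h by (metis inj_onI singleton_inject)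
      then have "card (J - {i}) = card (h ` (J - {i}))" by (simp add: card_image)
      also have "\<dots> \<le> card (c ` N w)"
      proof (rule card_clique[OF prw _ order_refl])
        have *: "h ` (J - {i}) \<subseteq> N w - insert t (N t)" using h tw by fastforce
        then show "h ` (J - {i}) \<subseteq> N w" by blast
        fix x y assume "x \<in> h ` (J - {i})" "y \<in> h ` (J - {i})" "x \<noteq> y"
        then show "y \<in> N x" using nonneighbors_clique[OF tw(1)] * by blast
      qed
      finally show False using Jbig cw i fJ by simp
    qed
    then obtain j where j: "j \<in> J" "j \<noteq> i" "{s \<in> X \<inter> N w. o1 s = {j}} \<subseteq> N t" by blast
    have jw: "j \<notin> c ` N w" "j < k" using j Jk by (auto simp: J_def)
    have jt: "j \<noteq> c t" using jw tw by blast
    define c' where "c' = c(w := j)"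
    have tok': "token X t c'"
      unfolding c'_def using j(3) by (intro token_move[OF tok jw(2,1)]) (simp add: o1_def)
    \<comment> \<open>The color that \<open>s\<close> forbids to \<open>t\<close>, if any; junk when
      the set of odd colors is not a singleton.\<close>
    define h where "h s = the_elem (odds c' (N s - {t}))" for s
    define B where "B = N t - insert w (N w)"
    define R where "R = {s \<in> S. t \<in> N s \<and> c t \<in> o1 s}"
    define U where "U = c ` (N t - {w}) \<union> {j, c t, h w} \<union> h ` B \<union> h ` R"
    have fin': "finite B" "finite R" using fS by (auto simp: B_def R_def)
    \<comment> \<open>Only \<open>i\<close> is odd on \<open>N t - {w}\<close>, so nearly all colors
      there occur twice.\<close>
    have ct: "2 * card (c ` (N t - {w})) = card (N t)"
      using card_image_odds[OF prs, of t t] tw wt card_Suc_Diff1[OF fin wt(1)]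
      by (simp add: o1_def)
    have cB: "card B \<le> card (c ` (N t - {w}))"
    proof (rule card_clique[OF prs])
      show "B \<subseteq> N t - {w}" "N t - {w} \<subseteq> N t" by (auto simp: B_def)
      fix x y assume "x \<in> B" "y \<in> B" "x \<noteq> y"
      then show "y \<in> N x" unfolding B_def by (rule nonneighbors_clique[OF wt(1)])
    qed
    have "card {j, c t, h w} \<le> 3" by (simp add: card_insert_if)
    moreover have "card (h ` B) \<le> card B" "card (h ` R) \<le> card R"
      using fin' by (auto intro: card_image_le)
    moreover have "card R \<le> 2" using few by (simp add: R_def)
    moreover have "card U \<le> card (c ` (N t - {w})) + card {j, c t, h w} + card (h ` B) + card (h ` R)"
      unfolding U_def by (intro order_trans[OF card_Un_le] add_mono order_refl)
    \<comment> \<open>The sum is at most \<open>d(t)/2 + 3 + d(t)/2 + 2\<close>, just below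
      \<open>k\<close>.\<close>
    ultimately have "card U < k" using ct cB deg[of t] by linarith
    moreover have "finite U" using fin' by (simp add: U_def)
    ultimately have "\<not> {..<k} \<subseteq> U" by (metis card_lessThan card_mono not_less)
    then obtain g where g: "g < k" "g \<notin> U" by auto
    have "solves X (c'(t := g))"
    proof (rule solves_upd[OF tok' g(1)])
      show "g \<notin> c' ` N t" using g(2) by (auto simp: U_def c'_def)
      fix s assume s: "s \<in> X \<inter> N t"
      show "odds c' (N s - {t}) \<noteq> {g}"
      proof
        assume eq: "odds c' (N s - {t}) = {g}"
        then have "h s = g" by (simp add: h_def)
        then have "s \<noteq> w" "s \<notin> B" "s \<notin> R" using g(2) by (auto simp: U_def)
        then have sw: "s \<in> N w" using s by (auto simp: B_def)
        have ts: "t \<in> N s" "w \<in> N s" using s sw sym by auto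
        \<comment> \<open>The move flips the parities of \<open>j\<close>, now on \<open>w\<close>,
          and of \<open>c t\<close>, taken off \<open>t\<close>.\<close>
        have tog: "x \<in> odds c' (N s - {t}) \<longleftrightarrow> ((x \<in> o1 s) \<noteq> (x = j)) \<noteq> (x = c t)" for x
          using odds_remove[OF fin ts(1), of x c'] odds_upd_in[OF ts(2), of x c j] wt(2)
          by (auto simp: c'_def o1_def)
        have gj: "g \<noteq> j" "g \<noteq> c t" using g(2) by (auto simp: U_def)
        have "x \<in> o1 s \<longleftrightarrow> x \<in> {g, j, c t}" for x
          using tog[of x] eq gj jt by auto
        then have o1s: "o1 s = {g, j, c t}" by (rule set_eqI)
        then have "card (o1 s) = 3" "c t \<in> o1 s" using gj jt by simp_all
        then have "s \<in> R" using sw ts by (simp add: R_def S_def)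
        then show False using \<open>s \<notin> R\<close> by simp
      qed
    qed
    then show ?thesis by blast
  qed
qed

section \<open>Satisfying one more vertex\<close>

lemma solve_insert:
  assumes sol: "solves X c" and v: "N v \<noteq> {}"
  shows "\<exists>c'. solves (insert v X) c'"
proof (cases "odds c (N v) = {}")
  case False
  then have "solves (insert v X) c" using sol by (simp add: solves_def)
  then show ?thesis by blast
next
  case v0: True
  have pr: "proper_on UNIV c" using sol by (simp add: solves_def)
  have prs: "proper_on S c" for S by (rule proper_on_subset[OF pr]) auto
  have ck: "c u < k" for u using pr by (auto simp: proper_on_def)
  \<comment> \<open>\<open>R q s\<close> is necessary for \<open>s\<close> to forbid \<open>q\<close> a color different from \<open>c q\<close>.\<close>
  define R where "R q s \<longleftrightarrow> q \<in> N s \<and> card (odds c (N s)) = 2 \<and> c q \<in> odds c (N s)" for q s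
  \<comment> \<open>For each \<open>s\<close>, only the two vertices that carry its odd colors
    count, so some \<open>q\<close> is counted fewer than three times.\<close>
  have "(\<Sum>s\<in>N v. card {q \<in> N v. R q s}) \<le> (\<Sum>s\<in>N v. 2)"
  proof (rule sum_mono)
    fix s
    show "card {q \<in> N v. R q s} \<le> 2"
    proof (cases "card (odds c (N s)) = 2")
      case True
      then show ?thesis
        using card_odds_vertices_le[OF prs, of "N s" s "{q \<in> N v. R q s}"] by (force simp: R_def)
    qed (simp add: R_def)
  qed
  also have "\<dots> < 3 * card (N v)" using v by (simp add: card_gt_0_iff)
  finally obtain q where q: "q \<in> N v" and few: "card {s \<in> N v. R q s} < 3"
    using ex_few[OF fin fin] by blast
  have vq: "v \<in> N q" using q sym by blast
  define Y where "Y = insert v X"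
  have tok: "token Y q c" using sol vq prs by (auto simp: token_def solves_def Y_def)
  define o1 where "o1 s = odds c (N s - {q})" for s
  \<comment> \<open>\<open>c q\<close> is the color that \<open>v\<close> forbids, since all colors
    are even on \<open>N v\<close>. The other elements cover the common neighbors of
    \<open>v\<close> and \<open>q\<close>.\<close>
  define E where "E = insert (c q) ((\<lambda>s. the_elem (o1 s)) ` {s \<in> N v. R q s})"
  \<comment> \<open>With \<open>q\<close> colored \<open>c q\<close> again, the odd colors on
    \<open>N s\<close> are \<open>g\<close> and \<open>c q\<close>. So \<open>s \<noteq> v\<close>,
    and \<open>s \<in> N v\<close> would put \<open>g\<close> into \<open>E\<close>.\<close>
  have far: "s \<notin> insert v (N v)" if s: "s \<in> Y \<inter> N q" "o1 s = {g}" "g \<notin> E" for s g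
  proof
    assume sv: "s \<in> insert v (N v)"
    have qs: "q \<in> N s" using s sym by blast
    have tog: "x \<in> odds c (N s) \<longleftrightarrow> (x = g) \<noteq> (x = c q)" for x
      using odds_remove[OF fin qs, of x c] s(2) by (simp add: o1_def)
    have gq: "g \<noteq> c q" using s by (auto simp: E_def)
    with tog have os: "odds c (N s) = {g, c q}" by blast
    then have "s \<noteq> v" using v0 by auto
    with sv have "s \<in> N v" by simp
    moreover have "R q s" using qs os gq by (simp add: R_def)
    ultimately have "the_elem (o1 s) \<in> E" by (auto simp: E_def)
    then show False using s by simp
  qed
  define J where "J = {j. \<exists>s\<in>Y \<inter> N q. o1 s = {j}}"
  have fE: "finite E" by (simp add: E_def)
  have "card ((\<lambda>s. the_elem (o1 s)) ` {s \<in> N v. R q s}) \<le> card {s \<in> N v. R q s}"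
    by (simp add: card_image_le)
  then have "card E \<le> Suc (card {s \<in> N v. R q s})"
    by (simp add: E_def card_insert_if)
  then have cE: "card E \<le> 3" using few by simp
  define J' where "J' = J - (c ` N q \<union> E)"
  have Jk: "J \<subseteq> {..<k}"
    using odds_subset_image[of c] ck by (fastforce simp: J_def o1_def)
  then have fJ: "finite J'" using finite_subset by (auto simp: J'_def)
  show ?thesis
  proof (cases "{..<k} \<subseteq> c ` N q \<union> E \<union> J'")
    case False
    then obtain g where g: "g < k" "g \<notin> c ` N q" "g \<notin> E" "g \<notin> J" by (auto simp: J'_def)
    then have "solves Y (c(q := g))"
      by (intro solves_upd[OF tok]) (auto simp: J_def o1_def)
    then show ?thesis by (auto simp: Y_def)
  next
    case True
    have "k \<le> card (c ` N q \<union> E \<union> J')" using card_mono[OF _ True] fJ fE by simp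
    also have "\<dots> \<le> card (c ` N q) + card E + card J'"
      by (intro order_trans[OF card_Un_le] add_mono order_refl)
    also have "\<dots> \<le> card (N q) + 3 + card J'" using cE card_image_le[OF fin, of c q] by simp
    finally have "2 \<le> card J'" using deg[of q] by linarith
    then obtain i j where ij: "i \<in> J'" "j \<in> J'" "i \<noteq> j"
      by (metis card_le_Suc0_iff_eq fJ not_less_eq_eq numeral_2_eq_2)
    obtain t where t: "t \<in> Y \<inter> N q" "o1 t = {i}" using ij by (auto simp: J'_def J_def)
    have tv: "t \<notin> insert v (N v)" using far[OF t] ij by (simp add: J'_def)
    \<comment> \<open>The neighbors of \<open>q\<close> outside \<open>v\<close> and
      \<open>N v\<close> form a clique.\<close>
    have "{s \<in> Y \<inter> N q. o1 s = {j}} \<subseteq> N t"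
    proof
      fix s assume s: "s \<in> {s \<in> Y \<inter> N q. o1 s = {j}}"
      then have "s \<notin> insert v (N v)" using far[of s j] ij by (auto simp: J'_def)
      moreover have "s \<noteq> t" using s t ij by auto
      ultimately show "s \<in> N t" using nonneighbors_clique[OF vq, of t s] s t tv by blast
    qed
    then have "token Y t (c(q := j))"
      using ij Jk by (intro token_move[OF tok]) (auto simp: o1_def J'_def)
    moreover have "odds (c(q := j)) (N t) = {i, j}"
    proof -
      have "q \<in> N t" using t sym by blast
      then show ?thesis using odds_upd_in[of q t _ c j] t(2) ij(3) by (auto simp: o1_def)
    qed
    ultimately show ?thesis using solve_two_odds[of Y t "c(q := j)"] ij(3) by (simp add: Y_def)
  qed
qed

section \<open>Initial greedy coloring, and induction over the vertices\<close>

lemma ex_proper_on: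
  assumes "finite A"
  shows "\<exists>c. proper_on A c"
  using assms
proof (induction rule: finite_induct)
  case empty
  have "0 < k" using deg[of undefined] by simp
  then have "proper_on {} (\<lambda>_. 0)" by (auto simp: proper_on_def)
  then show ?case by blast
next
  case (insert a A)
  then obtain c where c: "proper_on A c" by blast
  have "card (c ` N a) < card {..<k}"
    using deg[of a] card_image_le[OF fin, of c a] by simp
  then have "\<not> {..<k} \<subseteq> c ` N a" by (meson card_mono fin finite_imageI not_less)
  then obtain j where j: "j < k" "j \<notin> c ` N a" by auto
  have "proper_on (insert a A) (c(a := j))"
    unfolding proper_on_def
  proof (intro conjI ballI impI)
    show "range (c(a := j)) \<subseteq> {..<k}" using c j by (auto simp: proper_on_def)
    fix x y assume "x \<in> insert a A" "y \<in> insert a A" "y \<in> N x"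
    moreover from this have "x \<noteq> y" "x \<in> N y" using sym by auto
    ultimately show "(c(a := j)) x \<noteq> (c(a := j)) y"
      using c j by (cases "x = a"; cases "y = a") (auto simp: proper_on_def)
  qed
  then show ?case by blast
qed

lemma ex_solves:
  assumes "finite {v. N v \<noteq> {}}"
  shows "\<exists>c. solves {v. N v \<noteq> {}} c"
proof -
  have "\<exists>c. solves X c" if "finite X" "X \<subseteq> {v. N v \<noteq> {}}" for X
    using that
  proof (induction rule: finite_induct)
    case empty
    obtain c where "proper_on {v. N v \<noteq> {}} c" using ex_proper_on[OF assms] by blast
    \<comment> \<open>Both ends of an edge are nonisolated, so the coloring is proper
      everywhere.\<close>
    then have "solves {} c" using sym by (force simp: proper_on_def solves_def)
    then show ?case by blast
  next
    case (insert v X)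
    then show ?case using solve_insert by blast
  qed
  then show ?thesis using assms by blast
qed

end

section \<open>From graphs to neighborhood functions\<close>

lemma claw_free_neighborhood:
  assumes "graph G" "claw_free G"
    and nb: "x \<in> neighborhood G v" "y \<in> neighborhood G v" "z \<in> neighborhood G v"
    and ne: "x \<noteq> y" "x \<noteq> z" "y \<noteq> z"
  shows "y \<in> neighborhood G x \<or> z \<in> neighborhood G x \<or> z \<in> neighborhood G y"
proof (rule ccontr)
  assume neg: "\<not> ?thesis"
  interpret graph G by fact
  have sy: "b \<rightarrow>\<^bsub>G\<^esub> a" if "a \<rightarrow>\<^bsub>G\<^esub> b" for a b
    using arcs_ends_symmetric[OF sym_arcs that] .
  have adj: "v \<rightarrow>\<^bsub>G\<^esub> x" "v \<rightarrow>\<^bsub>G\<^esub> y" "v \<rightarrow>\<^bsub>G\<^esub> z" "\<not> x \<rightarrow>\<^bsub>G\<^esub> y" "\<not> x \<rightarrow>\<^bsub>G\<^esub> z" "\<not> y \<rightarrow>\<^bsub>G\<^esub> z"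
    using nb neg by (auto simp: neighborhood_def)
  have loopless: "\<not> a \<rightarrow>\<^bsub>G\<^esub> a" for a using adj_not_same by blast
  have vne: "v \<noteq> x" "v \<noteq> y" "v \<noteq> z" using adj loopless by auto
  define W where "W = {v, x, y, z}"
  have WG: "W \<subseteq> verts G" using adj by (auto simp: W_def dest: adj_in_verts)
  have ind: "induced_subgraph (G \<restriction> W) G" using induced_induce[OF WG] .
  have ends: "arcs_ends (G \<restriction> W) = {(a, b). a \<rightarrow>\<^bsub>G\<^esub> b \<and> a \<in> W \<and> b \<in> W}"
    by (auto simp: arcs_ends_conv induce_subgraph_def)
  have "symmetric (G \<restriction> W)" unfolding symmetric_def ends by (rule symI) (use sy in auto)
  then have "graph (G \<restriction> W)" using digraph.graphI digraphI_induced[OF ind] by blast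
  moreover have "arcs_ends (G \<restriction> W) = {v} \<times> {x, y, z} \<union> {x, y, z} \<times> {v}"
    unfolding ends using adj sy loopless vne by (auto simp: W_def)
  moreover have "verts (G \<restriction> W) = {v} \<union> {x, y, z}" by (auto simp: W_def)
  moreover have "{v} \<inter> {x, y, z} = {}" "card {v} = 1" "card {x, y, z} = 3" using vne ne by auto
  ultimately have "K\<^bsub>1,3\<^esub> (G \<restriction> W)" unfolding complete_bipartite_digraph_def by metis
  then show False using ind assms(2) by (auto simp: claw_free_def)
qed

theorem theorem1p9:
  fixes G :: "('a, 'b) pre_digraph"
  assumes "graph G" and "claw_free G"
  shows "pcf_chromatic_number G \<le> max_degree G + 6"
proof -
  interpret graph G by fact
  have sub: "neighborhood G v \<subseteq> verts G" for v
    by (auto simp: neighborhood_def dest: adj_in_verts)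
  have empty: "neighborhood G v = {}" if "v \<notin> verts G" for v
    using that by (auto simp: neighborhood_def dest: adj_in_verts)
  interpret claw_free_nbhds "neighborhood G" "max_degree G + 6"
  proof
    fix u v x y z
    show "finite (neighborhood G v)" using sub finite_verts by (rule finite_subset)
    show "v \<in> neighborhood G u" if "u \<in> neighborhood G v"
      using that arcs_ends_symmetric[OF sym_arcs] by (simp add: neighborhood_def)
    show "v \<notin> neighborhood G v" using adj_not_same by (auto simp: neighborhood_def)
    show "y \<in> neighborhood G x \<or> z \<in> neighborhood G x \<or> z \<in> neighborhood G y"
      if "x \<in> neighborhood G v" "y \<in> neighborhood G v" "z \<in> neighborhood G v" "x \<noteq> y" "x \<noteq> z" "y \<noteq> z"
      using claw_free_neighborhood[OF assms that] .
    \<comment> \<open>Outside \<open>verts G\<close> the neighborhood is empty, which extends the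
      bound to the whole type.\<close>
    show "card (neighborhood G v) + 6 \<le> max_degree G + 6"
      using empty[of v] by (cases "v \<in> verts G") (auto simp: max_degree_def intro: Max_ge)
  qed
  have "finite {v. neighborhood G v \<noteq> {}}"
    by (rule finite_subset[OF _ finite_verts]) (use empty in blast)
  then obtain c where c: "solves {v. neighborhood G v \<noteq> {}} c" using ex_solves by blast
  then have pr: "proper_on UNIV c" by (simp add: solves_def)
  have "\<exists>i. \<exists>!u. u \<in> neighborhood G v \<and> c u = i" if "neighborhood G v \<noteq> {}" for v
  proof -
    have "odds c (neighborhood G v) \<noteq> {}" using c that by (simp add: solves_def)
    then obtain i where "i \<in> odds c (neighborhood G v)" by blast
    then have "odd (card {u \<in> neighborhood G v. c u = i})" by (simp add: odds_def)
    \<comment> \<open>An odd multiplicity of at most two is one.\<close>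
    moreover have "card {u \<in> neighborhood G v. c u = i} \<le> 2"
      by (rule card_color_le_2[OF proper_on_subset[OF pr]]) auto
    ultimately have "card {u \<in> neighborhood G v. c u = i} = 1" by presburger
    then obtain u where u: "{u \<in> neighborhood G v. c u = i} = {u}"
      by (auto simp: card_1_singleton_iff)
    have "w \<in> neighborhood G v \<and> c w = i \<longleftrightarrow> w = u" for w using u by (auto simp: set_eq_iff)
    then show ?thesis by (intro exI[of _ i]) simp
  qed
  moreover have "proper_coloring G c"
    using pr by (simp add: proper_coloring_def proper_on_def neighborhood_def)
  ultimately have "pcf_colorable G (max_degree G + 6)"
    unfolding pcf_colorable_def pcf_coloring_def
    using pr by (intro exI[of _ c] conjI ballI impI) (auto simp: proper_on_def image_subset_iff)
  then show ?thesis unfolding pcf_chromatic_number_def by (rule Least_le)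
qed

end
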